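(* Let $d=4096$. Consider the test $D$ which, given a vector of $d$ integer coefficients, declares it genuine if the number of zero coefficients is at least a cutoff $\tau$, and fake otherwise. For $p=1/3$ and $\tau=1210$, $$\Pr[D(\text{fake})=\text{genuine}]=1.046943719579\cdot10^{-7},\qquad \Pr[D(\text{genuine})=\text{fake}]=9.114537336335\cdot10^{-8}$$ to the displayed precision, so that the advantage of $D$ is $0.999999804160$ to the displayed precision. For $p=5/16$ the optimal cutoff is $\tau=1235$, and it gives advantage $0.999997734193$ to the displayed precision.
   Context: A genuine vector has $d$ independent coefficients distributed as $Y=X_1+X_2$, where $X_1,X_2$ are independent with $\Pr[X_i=1]=\Pr[X_i=-1]=p$, $\Pr[X_i=0]=1-2p$; thus $\Pr[Y=0]=1-4p+6p^2$. A fake vector has $d$ independent coefficients distributed as $Y^*$, where $\Pr[Y^*=2]=\Pr[Y^*=-2]=p^2$ and $\Pr[Y^*=-1]=\Pr[Y^*=0]=\Pr[Y^*=1]=(1-2p^2)/3$. The zero counts are therefore binomial with $d$ trials and success probabilities $1-4p+6p^2$ (genuine) and $(1-2p^2)/3$ (fake). The advantage of $D$ is $1-\Pr[D(\text{fake})=\text{genuine}]-\Pr[D(\text{genuine})=\text{fake}]$; the optimal cutoff is the one maximizing the advantage. *)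

theory Defs
  imports "HOL-Probability.Probability"
begin

text \<open>The distributions are meaningful for \<open>0 \<le> p \<le> 1/2\<close>, where the weight lists below
  are well-formed; outside this range \<^const>\<open>pmf_of_list\<close> is unspecified.\<close>

definition step_weights :: "real \<Rightarrow> (int \<times> real) list" where
  "step_weights p = [(1, p), (-1, p), (0, 1 - 2 * p)]"

definition fake_weights :: "real \<Rightarrow> (int \<times> real) list" where
  "fake_weights p = [(2, p^2), (-2, p^2),
     (-1, (1 - 2 * p^2) / 3), (0, (1 - 2 * p^2) / 3), (1, (1 - 2 * p^2) / 3)]"

lemma step_weights_wf: "0 \<le> p \<Longrightarrow> p \<le> 1 / 2 \<Longrightarrow> pmf_of_list_wf (step_weights p)"
  by (auto simp: pmf_of_list_wf_def step_weights_def)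

lemma fake_weights_wf:
  assumes "0 \<le> p" "p \<le> 1 / 2"
  shows "pmf_of_list_wf (fake_weights p)"
proof -
  have "p^2 \<le> (1 / 2)^2"
    using assms by (intro power_mono) auto
  then show ?thesis
    by (auto simp: pmf_of_list_wf_def fake_weights_def power2_eq_square field_simps)
qed

definition genuine_coeff_pmf :: "real \<Rightarrow> int pmf" where
  "genuine_coeff_pmf p =
     map_pmf (\<lambda>(x1, x2). x1 + x2)
       (pair_pmf (pmf_of_list (step_weights p)) (pmf_of_list (step_weights p)))"

definition fake_coeff_pmf :: "real \<Rightarrow> int pmf" where
  "fake_coeff_pmf p = pmf_of_list (fake_weights p)"

definition genuine_vec_pmf :: "nat \<Rightarrow> real \<Rightarrow> int list pmf" where
  "genuine_vec_pmf d p = replicate_pmf d (genuine_coeff_pmf p)"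

definition fake_vec_pmf :: "nat \<Rightarrow> real \<Rightarrow> int list pmf" where
  "fake_vec_pmf d p = replicate_pmf d (fake_coeff_pmf p)"

datatype verdict = Genuine | Fake

definition zero_test :: "nat \<Rightarrow> int list \<Rightarrow> verdict" where
  "zero_test \<tau> v = (if \<tau> \<le> count_list v 0 then Genuine else Fake)"

definition prob_fake_as_genuine :: "nat \<Rightarrow> real \<Rightarrow> (int list \<Rightarrow> verdict) \<Rightarrow> real" where
  "prob_fake_as_genuine d p D = measure_pmf.prob (fake_vec_pmf d p) {v. D v = Genuine}"

definition prob_genuine_as_fake :: "nat \<Rightarrow> real \<Rightarrow> (int list \<Rightarrow> verdict) \<Rightarrow> real" where
  "prob_genuine_as_fake d p D = measure_pmf.prob (genuine_vec_pmf d p) {v. D v = Fake}"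

definition advantage :: "nat \<Rightarrow> real \<Rightarrow> (int list \<Rightarrow> verdict) \<Rightarrow> real" where
  "advantage d p D = 1 - prob_fake_as_genuine d p D - prob_genuine_as_fake d p D"

text \<open>For a decimal \<open>v\<close> with \<open>k\<close> digits after the point: \<open>v\<close> is \<open>x\<close> rounded to nearest
  at \<open>k\<close> digits.\<close>

definition rounds_to :: "real \<Rightarrow> real \<Rightarrow> nat \<Rightarrow> bool" where
  "rounds_to x v k \<longleftrightarrow> \<bar>x - v\<bar> < 1 / (2 * 10 ^ k)"

end

(* The number of zero coefficients is binomially distributed, so both error probabilities are binomial
   tails (the lower one is an upper tail after reflection).  An upper tail starting at k is its first
   term times 1 + r_k (1 + r_{k+1} (1 + ...)), where r_j is the quotient of consecutive terms; once
   r_k <= 7/8, every such nested sum is between 1 and 8, so truncating it costs exponentially little.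
   The first term and the nested sum are evaluated in integer interval arithmetic inside the logic.
   The binomial coefficients all come from 4096 choose 1209, obtained as the quotient of two products
   so that the long loop contains no division by anything but powers of two.

   Raising the cutoff from k to k + 1 changes the advantage by the fake minus the genuine point mass at
   k.  The likelihood ratio is monotone in k and crosses 1 between 1234 and 1235. *)

theory Submission
  imports Defs
begin

section \<open>Zero counts are binomial\<close>

text \<open>Coefficients are independent, so peeling off the first one reproduces the recursion of
  the binomial law, once the Bernoulli variable is read as the indicator of
  \<open>y = x\<close>.\<close>

lemma count_list_replicate_pmf:
  "map_pmf (\<lambda>v. count_list v x) (replicate_pmf n P) = binomial_pmf n (pmf P x)"
proof (induction n)
  case 0
  show ?case by (simp add: binomial_pmf_0 pmf_le_1)
next
  case (Suc n)
  have bern: "bernoulli_pmf (pmf P x) = map_pmf (\<lambda>y. y = x) P"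
  proof (rule pmf_eqI)
    fix b
    have "pmf (map_pmf (\<lambda>y. y = x) P) True = pmf P x"
      by (simp add: pmf_map pmf.rep_eq vimage_def)
    moreover have "pmf (map_pmf (\<lambda>y. y = x) P) False = 1 - pmf P x"
      using measure_pmf.prob_compl[of "{x}" P]
      by (simp add: pmf_map pmf.rep_eq vimage_def Compl_eq_Diff_UNIV[symmetric] Compl_eq)
    ultimately show "pmf (bernoulli_pmf (pmf P x)) b = pmf (map_pmf (\<lambda>y. y = x) P) b"
      by (cases b) (simp_all add: pmf_le_1)
  qed
  show ?case
    by (simp add: binomial_pmf_Suc pmf_le_1 bern Suc.IH[symmetric] map_pmf_def bind_assoc_pmf
        bind_return_pmf of_bool_def add.commute cong: if_cong) (intro bind_pmf_cong refl, auto)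
qed

lemma prob_count_list:
  "measure_pmf.prob (replicate_pmf n P) {v. Q (count_list v x)} =
   measure_pmf.prob (binomial_pmf n (pmf P x)) {k. Q k}"
  by (subst count_list_replicate_pmf[symmetric]) (simp add: vimage_def)

lemma pmf_fake_coeff_0:
  assumes "0 \<le> p" "p \<le> 1 / 2"
  shows "pmf (fake_coeff_pmf p) 0 = (1 - 2 * p^2) / 3"
  using fake_weights_wf[OF assms]
  by (simp add: fake_coeff_pmf_def pmf_pmf_of_list) (simp add: fake_weights_def)

text \<open>The sum vanishes exactly when the second step is the negative of the first, which leaves
  three pairs of total mass \<open>(1 - 2 * p)^2 + 2 * p^2\<close>.\<close>

lemma pmf_genuine_coeff_0:
  assumes "0 \<le> p" "p \<le> 1 / 2"
  shows "pmf (genuine_coeff_pmf p) 0 = 1 - 4 * p + 6 * p^2"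
proof -
  let ?S = "pmf_of_list (step_weights p)"
  note wf = step_weights_wf[OF assms]
  have S: "pmf ?S x = (if x = 0 then 1 - 2 * p else if \<bar>x\<bar> = 1 then p else 0)" for x
    by (subst pmf_pmf_of_list[OF wf]) (auto simp: step_weights_def)
  have sub: "set_pmf ?S \<subseteq> {1, -1, 0}"
    using set_pmf_of_list[OF wf] by (simp add: step_weights_def)
  have gen: "genuine_coeff_pmf p = bind_pmf ?S (\<lambda>x. map_pmf (\<lambda>y. x + y) ?S)"
    by (simp add: genuine_coeff_pmf_def pair_pmf_def map_bind_pmf map_pmf_def bind_assoc_pmf bind_return_pmf)
  have shift: "pmf (map_pmf (\<lambda>y. x + y) ?S) 0 = pmf ?S (-x)" for x
    using pmf_map_inj'[of "\<lambda>y. x + y" ?S "-x"] by simp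
  have "pmf (genuine_coeff_pmf p) 0 = (\<Sum>x\<in>{1, -1, 0}. pmf ?S (-x) * pmf ?S x)"
    using sub by (subst gen, subst pmf_bind, subst shift, subst integral_measure_pmf_real[of "{1, -1, 0}"]) auto
  also have "\<dots> = 1 - 4 * p + 6 * p^2"
    by (simp add: S power2_eq_square algebra_simps)
  finally show ?thesis .
qed

lemma prob_fake_as_genuine_zero_test:
  assumes "0 \<le> p" "p \<le> 1 / 2"
  shows "prob_fake_as_genuine d p (zero_test \<tau>) =
           measure_pmf.prob (binomial_pmf d ((1 - 2 * p^2) / 3)) {\<tau>..}"
  using prob_count_list[of d "fake_coeff_pmf p" "\<lambda>k. \<tau> \<le> k" 0] pmf_fake_coeff_0[OF assms]
  by (simp add: prob_fake_as_genuine_def fake_vec_pmf_def zero_test_def atLeast_def)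

lemma prob_genuine_as_fake_zero_test:
  assumes "0 \<le> p" "p \<le> 1 / 2"
  shows "prob_genuine_as_fake d p (zero_test \<tau>) =
           measure_pmf.prob (binomial_pmf d (1 - 4 * p + 6 * p^2)) {..<\<tau>}"
  using prob_count_list[of d "genuine_coeff_pmf p" "\<lambda>k. \<not> \<tau> \<le> k" 0] pmf_genuine_coeff_0[OF assms]
  by (simp add: prob_genuine_as_fake_def genuine_vec_pmf_def zero_test_def lessThan_def not_le)

section \<open>The optimal cutoff\<close>

lemma prob_atLeast: "measure_pmf.prob P {j..} = pmf P j + measure_pmf.prob P {Suc j..}"
proof -
  have "{j..} = {j} \<union> {Suc j..}" by auto
  then show ?thesis
    using measure_pmf.finite_measure_Union[of "{j}" P "{Suc j..}"] by (simp add: pmf.rep_eq)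
qed

text \<open>Only vectors with exactly \<open>\<tau>\<close> zeros change their verdict.\<close>

lemma advantage_zero_test_Suc:
  assumes "0 \<le> p" "p \<le> 1 / 2"
  shows "advantage d p (zero_test (Suc \<tau>)) - advantage d p (zero_test \<tau>) =
           pmf (binomial_pmf d ((1 - 2 * p^2) / 3)) \<tau> - pmf (binomial_pmf d (1 - 4 * p + 6 * p^2)) \<tau>"
proof -
  note prob_atLeast[of _ \<tau>]
  moreover have "measure_pmf.prob P {..<Suc \<tau>} = measure_pmf.prob P {..<\<tau>} + pmf P \<tau>" for P
  proof -
    have "{..<Suc \<tau>} = {..<\<tau>} \<union> {\<tau>}" by auto
    then show ?thesis
      using measure_pmf.finite_measure_Union[of "{..<\<tau>}" P "{\<tau>}"] by (simp add: pmf.rep_eq)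
  qed
  ultimately show ?thesis
    by (simp add: advantage_def prob_fake_as_genuine_zero_test[OF assms]
        prob_genuine_as_fake_zero_test[OF assms])
qed

text \<open>Weak decrease beyond the peak suffices, since later values are then at most
  \<open>f (Suc m)\<close>, hence below the peak. This matters because the advantage is constant for
  cutoffs beyond the vector length.\<close>

lemma is_arg_max_unimodal:
  fixes f :: "nat \<Rightarrow> real"
  assumes up: "\<And>i. i < m \<Longrightarrow> f i < f (Suc i)"
    and peak: "f (Suc m) < f m"
    and down: "\<And>i. m < i \<Longrightarrow> f (Suc i) \<le> f i"
  shows "{i. is_arg_max f (\<lambda>_. True) i} = {m}"
proof -
  have less: "f i < f m" if "i \<noteq> m" for i
  proof (cases "i < m")
    case True
    then show ?thesis
    proof (induction rule: strict_inc_induct)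
      case (base i)
      then show ?case using up[of i] by simp
    next
      case (step i)
      then show ?case using up[of i] by simp
    qed
  next
    case False
    then have "Suc m \<le> i" using that by simp
    then show ?thesis
    proof (induction rule: dec_induct)
      case base
      show ?case by (rule peak)
    next
      case (step i)
      then show ?case using down[of i] by simp
    qed
  qed
  then have le: "f i \<le> f m" for i
    by (cases "i = m") (auto intro: less_imp_le)
  show ?thesis
    using less le by (auto simp: is_arg_max_def not_less) (meson not_le)
qed

lemma pmf_binomial_ratio:
  fixes a b :: real
  assumes "0 < a" "a < 1" "0 < b" "b < 1" "k \<le> n"
  shows "pmf (binomial_pmf n a) k = pmf (binomial_pmf n b) k * ((a / b) ^ k * ((1 - a) / (1 - b)) ^ (n - k))"
  using assms by (simp add: power_divide)

text \<open>Since \<open>a < b\<close>, the likelihood ratio \<open>x ^ l * y ^ (n - l)\<close> does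
  not increase with \<open>l\<close>, so testing it at \<open>m - 1\<close> and \<open>m\<close>
  settles the sign of every increment. The variables \<open>k\<close>, \<open>j\<close>,
  \<open>i\<close> replace subtractions, so that numerals can be inserted.\<close>

lemma optimal_cutoff:
  fixes a b x y :: real
  assumes p: "0 \<le> p" "p \<le> 1 / 2"
    and a: "(1 - 2 * p^2) / 3 = a" and b: "1 - 4 * p + 6 * p^2 = b" and ab: "0 < a" "a < b" "b < 1"
    and x: "a / b = x" and y: "(1 - a) / (1 - b) = y"
    and m: "Suc k = m" "k + j = n" "m + i = n"
    and above: "1 < x ^ k * y ^ j" and below: "x ^ m * y ^ i < 1"
  shows "{\<tau>. is_arg_max (\<lambda>\<tau>. advantage n p (zero_test \<tau>)) (\<lambda>_. True) \<tau>} = {m}"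
proof -
  let ?A = "\<lambda>\<tau>. advantage n p (zero_test \<tau>)"
  let ?w = "\<lambda>l. x ^ l * y ^ (n - l)"
  have xy: "0 < x" "x \<le> 1" "1 \<le> y"
    using ab by (auto simp flip: x y)
  have mono: "?w l' \<le> ?w l" if "l \<le> l'" for l l'
    using xy that by (intro mult_mono power_decreasing power_increasing) auto
  have n: "n - k = j" "n - m = i" using m by simp_all
  \<comment> \<open>Factoring out the genuine mass leaves a sign governed by the ratio
    alone.\<close>
  have step: "?A (Suc l) - ?A l = pmf (binomial_pmf n b) l * (?w l - 1)" if "l \<le> n" for l
    using pmf_binomial_ratio[of a b l n] that ab unfolding advantage_zero_test_Suc[OF p] a b
    by (simp add: x y algebra_simps del: pmf_binomial)
  have pos: "0 < pmf (binomial_pmf n b) l" if "l \<le> n" for l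
    using that ab by simp
  show ?thesis
  proof (rule is_arg_max_unimodal)
    fix l assume "l < m"
    then have "1 < ?w l" "l \<le> n"
      using mono[of l k] above m n by auto
    then have "0 < ?A (Suc l) - ?A l"
      unfolding step[OF \<open>l \<le> n\<close>] using pos by (intro mult_pos_pos) auto
    then show "?A l < ?A (Suc l)" by simp
  next
    have "m \<le> n" using m by simp
    then have "?A (Suc m) - ?A m < 0"
      unfolding step[OF \<open>m \<le> n\<close>] using pos[of m] below n by (intro mult_pos_neg) auto
    then show "?A (Suc m) < ?A m" by simp
  next
    fix l assume "m < l"
    show "?A (Suc l) \<le> ?A l"
    proof (cases "l \<le> n")
      case True
      then have "?A (Suc l) - ?A l \<le> 0"
        unfolding step[OF True] using mono[of m l] below n \<open>m < l\<close> by (intro mult_nonneg_nonpos) auto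
      then show ?thesis by simp
    next
      case False
      then have "?A (Suc l) - ?A l = 0"
        using ab unfolding advantage_zero_test_Suc[OF p] a b by simp
      then show ?thesis by simp
    qed
  qed
qed

text \<open>The number of failures is binomial with parameter \<open>1 - q\<close>. For
  \<open>l \<le> n\<close>, \<open>l < k\<close> means \<open>n - l \<ge> j\<close>, which is why
  \<open>k + j\<close> is \<open>n + 1\<close> and not \<open>n\<close>.\<close>

lemma prob_binomial_lessThan_reflect:
  assumes "0 \<le> q" "q \<le> 1" "k + j = Suc n"
  shows "measure_pmf.prob (binomial_pmf n q) {..<k} = measure_pmf.prob (binomial_pmf n (1 - q)) {j..}"
proof -
  have sub: "set_pmf (binomial_pmf n r) \<subseteq> {..n}" if "r \<in> {0..1}" for r
    using that by (auto simp: set_pmf_binomial_eq split: if_splits)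
  have "measure_pmf.prob (binomial_pmf n q) {..<k} = measure_pmf.prob (binomial_pmf n q) {l. l < k \<and> l \<le> n}"
    using sub[of q] assms by (intro measure_prob_cong_0) (auto simp: pmf_eq_0_set_pmf)
  also have "\<dots> = (\<Sum>l\<in>{l. l < k \<and> l \<le> n}. pmf (binomial_pmf n q) l)"
    by (rule measure_measure_pmf_finite) simp
  also have "\<dots> = (\<Sum>l\<in>{j..n}. pmf (binomial_pmf n (1 - q)) l)"
    using assms by (intro sum.reindex_bij_witness[of _ "\<lambda>l. n - l" "\<lambda>l. n - l"])
      (auto simp: binomial_symmetric[symmetric])
  also have "\<dots> = measure_pmf.prob (binomial_pmf n (1 - q)) {j..n}"
    by (rule measure_measure_pmf_finite[symmetric]) simp
  also have "\<dots> = measure_pmf.prob (binomial_pmf n (1 - q)) {j..}"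
    using sub[of "1 - q"] assms by (intro measure_prob_cong_0) (auto simp: pmf_eq_0_set_pmf)
  finally show ?thesis .
qed

section \<open>Interval arithmetic on dyadic numbers\<close>

text \<open>The triple \<open>(l, h, e)\<close> stands for the interval from \<open>l * 2^e\<close> to \<open>h * 2^e\<close>.  The mantissas are
  integers because the code equations for \<^typ>\<open>nat\<close> are unary.  Normalisation shifts mantissas down
  but never below \<open>2^64\<close>.\<close>

definition encloses :: "int \<times> int \<times> int \<Rightarrow> real \<Rightarrow> bool" where
  "encloses = (\<lambda>(l, h, e) x. 0 \<le> l \<and> of_int l * 2 powi e \<le> x \<and> x \<le> of_int h * 2 powi e)"

lemma encloses_nonneg: "encloses X x \<Longrightarrow> 0 \<le> x"
  by (auto simp: encloses_def split: prod.splits intro: order_trans[rotated])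

text \<open>This is \<open>2^64\<close>: the threshold for normalised mantissas, and the fixed-point
  representation of 1 in the nested sums.\<close>

definition mantissa_one :: int where "mantissa_one = 18446744073709551616"

definition one_encl :: "int \<times> int \<times> int" where "one_encl = (mantissa_one, mantissa_one, -64)"

lemma encloses_one: "encloses one_encl 1"
  by (simp add: encloses_def one_encl_def mantissa_one_def power_int_minus)

text \<open>The candidate comes as an argument so that its components are named by pattern matching
  and its quotients are not written out twice.\<close>

fun prefer_normal_encl :: "int \<times> int \<times> int \<Rightarrow> int \<times> int \<times> int \<Rightarrow> int \<times> int \<times> int" where
  "prefer_normal_encl X (l, h, e) = (if mantissa_one \<le> l then (l, h, e) else X)"

fun shift_encl :: "int \<Rightarrow> int \<Rightarrow> int \<times> int \<times> int \<Rightarrow> int \<times> int \<times> int" where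
  "shift_encl D s (l, h, e) = prefer_normal_encl (l, h, e) (l div D, h div D + 1, e + s)"

text \<open>Every rounding rests on this: lower mantissas are floored, upper ones are floored and
  increased by one, so errors only widen intervals.\<close>

lemma of_int_div_bounds:
  assumes "0 < b"
  shows "(of_int (a div b) :: real) \<le> of_int a / of_int b"
    and "of_int a / of_int b \<le> (of_int (a div b + 1) :: real)"
  using real_of_int_div4[of a b] real_of_int_div3[of a b] by simp_all

lemma encloses_shift:
  assumes "encloses X x" "of_int D = (2 powi s :: real)"
  shows "encloses (shift_encl D s X) x"
proof -
  obtain l h e where X: "X = (l, h, e)" by (cases X)
  have "(0 :: real) < of_int D" unfolding assms(2) by simp
  then have D: "0 < D" by simp
  have e: "of_int m / of_int D * 2 powi (e + s) = (of_int m * 2 powi e :: real)" for m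
    using D by (simp add: power_int_add assms(2))
  have "of_int (l div D) * 2 powi (e + s) \<le> (of_int l * 2 powi e :: real)"
    unfolding e[symmetric] by (intro mult_right_mono of_int_div_bounds D) simp
  moreover have "of_int h * 2 powi e \<le> (of_int (h div D + 1) * 2 powi (e + s) :: real)"
    unfolding e[symmetric] by (intro mult_right_mono of_int_div_bounds D) simp
  ultimately show ?thesis
    using assms(1) D by (auto simp: X encloses_def pos_imp_zdiv_nonneg_iff)
qed

text \<open>The exponent is kept, so precision is lost only if the factor is small.\<close>

fun scale_encl :: "int \<Rightarrow> int \<Rightarrow> int \<times> int \<times> int \<Rightarrow> int \<times> int \<times> int" where
  "scale_encl a b (l, h, e) = (l * a div b, h * a div b + 1, e)"

lemma encloses_scale:
  assumes "encloses X x" "0 \<le> a" "0 < b"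
  shows "encloses (scale_encl a b X) (x * (of_int a / of_int b))"
proof -
  obtain l h e where X: "X = (l, h, e)" by (cases X)
  have "of_int (l * a div b) * 2 powi e \<le> (of_int (l * a) / of_int b * 2 powi e :: real)"
    by (intro mult_right_mono of_int_div_bounds assms) simp
  also have "\<dots> = of_int l * 2 powi e * (of_int a / of_int b)"
    by simp
  also have "\<dots> \<le> x * (of_int a / of_int b)"
    using assms by (intro mult_right_mono) (auto simp: X encloses_def)
  finally have lower: "of_int (l * a div b) * 2 powi e \<le> x * (of_int a / of_int b)" .
  have "x * (of_int a / of_int b) \<le> of_int h * 2 powi e * (of_int a / of_int b)"
    using assms by (intro mult_right_mono) (auto simp: X encloses_def)
  also have "\<dots> = (of_int (h * a) / of_int b * 2 powi e :: real)"
    by simp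
  also have "\<dots> \<le> of_int (h * a div b + 1) * 2 powi e"
    by (intro mult_right_mono of_int_div_bounds assms) simp
  finally have upper: "x * (of_int a / of_int b) \<le> of_int (h * a div b + 1) * 2 powi e" .
  show ?thesis
    using assms lower upper by (auto simp: X encloses_def pos_imp_zdiv_nonneg_iff)
qed

text \<open>For factors up to 4096 a single conditional shift by 12 bits keeps a lower mantissa
  below \<open>2^76\<close> if it was so before.\<close>

fun times_int_encl :: "int \<Rightarrow> int \<times> int \<times> int \<Rightarrow> int \<times> int \<times> int" where
  "times_int_encl i (l, h, e) = shift_encl 4096 12 (l * i, h * i, e)"

lemma encloses_times_int:
  assumes "encloses X x" "0 \<le> i"
  shows "encloses (times_int_encl i X) (x * of_int i)"
proof -
  obtain l h e where X: "X = (l, h, e)" by (cases X)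
  have "encloses (l * i, h * i, e) (x * of_int i)"
    using assms mult_right_mono[of _ _ "of_int i :: real"]
    by (fastforce simp: X encloses_def mult.assoc mult.commute[of _ "of_int i"] mult.left_commute[of _ "of_int i"])
  then have "encloses (shift_encl 4096 12 (l * i, h * i, e)) (x * of_int i)"
    by (rule encloses_shift) simp
  then show ?thesis
    by (simp add: X)
qed

text \<open>Halving the shift width works like a binary search: a lower mantissa from
  \<open>2^64\<close> up to \<open>2^192\<close> ends between \<open>2^64\<close> and
  \<open>2^68\<close>.\<close>

definition normalise_encl :: "int \<times> int \<times> int \<Rightarrow> int \<times> int \<times> int" where
  "normalise_encl X = shift_encl 16 4 (shift_encl 256 8 (shift_encl 65536 16 (shift_encl 4294967296 32
     (shift_encl 18446744073709551616 64 X))))"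

lemma encloses_normalise: "encloses X x \<Longrightarrow> encloses (normalise_encl X) x"
  by (simp add: normalise_encl_def encloses_shift)

fun times_encl :: "int \<times> int \<times> int \<Rightarrow> int \<times> int \<times> int \<Rightarrow> int \<times> int \<times> int" where
  "times_encl (l, h, e) (l', h', e') = normalise_encl (l * l', h * h', e + e')"

lemma encloses_times:
  assumes "encloses X x" "encloses Y y"
  shows "encloses (times_encl X Y) (x * y)"
proof -
  obtain l h e l' h' e' where XY: "X = (l, h, e)" "Y = (l', h', e')" by (cases X, cases Y)
  note nonneg = encloses_nonneg[OF assms(1)] encloses_nonneg[OF assms(2)]
  have "of_int l * 2 powi e * (of_int l' * 2 powi e') \<le> x * y"
    using assms nonneg by (intro mult_mono) (auto simp: XY encloses_def)
  moreover have "x * y \<le> of_int h * 2 powi e * (of_int h' * 2 powi e')"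
    using assms nonneg by (intro mult_mono) (auto simp: XY encloses_def)
  ultimately have "encloses (l * l', h * h', e + e') (x * y)"
    using assms by (simp add: XY encloses_def power_int_add mult_ac)
  then show ?thesis
    by (simp add: XY encloses_normalise)
qed

text \<open>The factor in the numerators is \<open>2^80\<close>; it keeps the quotients to about 80 bits.\<close>

fun quotient_encl :: "int \<times> int \<times> int \<Rightarrow> int \<times> int \<times> int \<Rightarrow> int \<times> int \<times> int" where
  "quotient_encl (l, h, e) (l', h', e') =
     (l * 1208925819614629174706176 div h', h * 1208925819614629174706176 div l' + 1, e - e' - 80)"

text \<open>Division is antitone in the divisor, so each endpoint is divided by the opposite
  endpoint of \<open>Y\<close>. The exponent \<open>-80\<close> undoes the factor in the
  numerators.\<close>

lemma encloses_quotient: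
  assumes "encloses X x" "encloses Y y" "0 < fst Y"
  shows "encloses (quotient_encl X Y) (x / y)"
proof -
  obtain l h e l' h' e' where XY: "X = (l, h, e)" "Y = (l', h', e')" by (cases X, cases Y)
  let ?c = "1208925819614629174706176"
  have l': "0 < l'" using assms by (simp add: XY)
  then have y: "0 < of_int l' * (2 :: real) powi e'" by simp
  also have le: "of_int l' * 2 powi e' \<le> y" using assms by (simp add: XY encloses_def)
  finally have ypos: "0 < y" .
  have ge: "y \<le> of_int h' * 2 powi e'" using assms by (simp add: XY encloses_def)
  with ypos have "0 < of_int h' * (2 :: real) powi e'" by linarith
  then have h': "0 < h'"
    using zero_less_mult_pos2[of "of_int h'" "(2 :: real) powi e'"] by simp
  have e: "2 powi (e - e' - 80) = (2 powi e / 2 powi e' / of_int ?c :: real)"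
    by (simp add: power_int_diff)
  have "of_int (l * ?c div h') * 2 powi (e - e' - 80)
          \<le> (of_int (l * ?c) / of_int h' * 2 powi (e - e' - 80) :: real)"
    by (intro mult_right_mono of_int_div_bounds h') simp
  also have "\<dots> = of_int l * 2 powi e / (of_int h' * 2 powi e')"
    unfolding e by simp
  also have "\<dots> \<le> x / y"
    using assms(1) ypos ge by (intro frac_le) (auto simp: XY encloses_def intro: order_trans[rotated])
  finally have lower: "of_int (l * ?c div h') * 2 powi (e - e' - 80) \<le> x / y" .
  have "x / y \<le> of_int h * 2 powi e / (of_int l' * 2 powi e')"
    using assms(1) y le by (intro frac_le) (auto simp: XY encloses_def intro: order_trans[rotated])
  also have "\<dots> = (of_int (h * ?c) / of_int l' * 2 powi (e - e' - 80) :: real)"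
    unfolding e by simp
  also have "\<dots> \<le> of_int (h * ?c div l' + 1) * 2 powi (e - e' - 80)"
    by (intro mult_right_mono of_int_div_bounds l') simp
  finally have upper: "x / y \<le> of_int (h * ?c div l' + 1) * 2 powi (e - e' - 80)" .
  show ?thesis
    using assms(1) lower upper h' by (auto simp: XY encloses_def pos_imp_zdiv_nonneg_iff)
qed

text \<open>A name of its own lets the recursive result in \<open>pow_encl\<close> occur once
  instead of twice.\<close>

definition square_encl :: "int \<times> int \<times> int \<Rightarrow> int \<times> int \<times> int" where
  "square_encl X = times_encl X X"

text \<open>Repeated squaring along the binary digits of the numeral; the exponent never becomes a
  unary natural number.\<close>

primrec pow_encl :: "int \<times> int \<times> int \<Rightarrow> num \<Rightarrow> int \<times> int \<times> int" where
  "pow_encl X num.One = X"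
| "pow_encl X (num.Bit0 n) = square_encl (pow_encl X n)"
| "pow_encl X (num.Bit1 n) = times_encl X (square_encl (pow_encl X n))"

lemma encloses_pow: "encloses X x \<Longrightarrow> encloses (pow_encl X n) (x ^ numeral n)"
proof (induction n)
  case (Bit0 n)
  then show ?case
    unfolding pow_encl.simps square_encl_def numeral_Bit0 power_add by (intro encloses_times)
next
  case (Bit1 n)
  then have "encloses (pow_encl X (num.Bit1 n)) (x * (x ^ numeral n * x ^ numeral n))"
    unfolding pow_encl.simps square_encl_def by (intro encloses_times)
  then show ?case
    by (simp only: numeral_Bit1 power_add power_one_right mult.commute)
qed simp

text \<open>A comparison with decimal fractions, cleared of denominators; \<open>e \<le> 0\<close>
  makes \<open>2 ^ nat (- e)\<close> the dyadic denominator, so only integers are compared.\<close>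

fun decimally_bounded :: "int \<Rightarrow> int \<Rightarrow> nat \<Rightarrow> int \<times> int \<times> int \<Rightarrow> bool" where
  "decimally_bounded A B d (l, h, e) \<longleftrightarrow> e \<le> 0 \<and> A * 2 ^ nat (- e) \<le> l * 10 ^ d \<and> h * 10 ^ d \<le> B * 2 ^ nat (- e)"

lemma decimally_bounded_bounds:
  assumes "encloses X x" "decimally_bounded A B d X"
  shows "of_int A / 10 ^ d \<le> x" "x \<le> of_int B / 10 ^ d"
proof -
  obtain l h e where X: "X = (l, h, e)" by (cases X)
  let ?p = "2 ^ nat (- e) :: real"
  have e: "2 powi e = 1 / ?p"
    using assms(2) by (simp add: X power_int_def inverse_eq_divide power_one_over)
  have "of_int (A * 2 ^ nat (- e)) \<le> (of_int (l * 10 ^ d) :: real)"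
    using assms(2) unfolding X decimally_bounded.simps of_int_le_iff by blast
  then have "of_int A / 10 ^ d \<le> of_int l / ?p"
    by (simp add: field_simps)
  also have "\<dots> \<le> x" using assms(1) by (simp add: X encloses_def e)
  finally show "of_int A / 10 ^ d \<le> x" .
  have "x \<le> of_int h / ?p" using assms(1) by (simp add: X encloses_def e)
  also have "of_int (h * 10 ^ d) \<le> (of_int (B * 2 ^ nat (- e)) :: real)"
    using assms(2) unfolding X decimally_bounded.simps of_int_le_iff by blast
  then have "of_int h / ?p \<le> of_int B / 10 ^ d"
    by (simp add: field_simps)
  finally show "x \<le> of_int B / 10 ^ d" .
qed

section \<open>Enclosing binomial tails\<close>

lemma encloses_prod_int:
  assumes "1 \<le> m"
  shows "encloses (fold times_int_encl [m..m + int k - 1] one_encl) (\<Prod>i<k. of_int m + of_nat i)"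
proof (induction k)
  case 0
  show ?case by (simp add: encloses_one)
next
  case (Suc k)
  have "[m..m + int (Suc k) - 1] = [m..m + int k - 1] @ [m + int k]"
    using upto_rec2[of m "m + int k"] by simp
  then show ?case
    using encloses_times_int[OF Suc.IH, of "m + int k"] assms by simp
qed

text \<open>Numerator and denominator are both products of consecutive integers, the form that
  \<open>encloses_prod_int\<close> handles; hence \<open>of_int 1\<close> in the factorial.\<close>

lemma binomial_quotient_prod:
  "(of_nat ((m + k) choose k) :: real) =
     (\<Prod>i<k. of_int (int m + 1) + of_nat i) / (\<Prod>i<k. of_int 1 + of_nat i)"
proof (induction k)
  case (Suc k)
  have "(Suc k) * ((m + Suc k) choose Suc k) = (m + Suc k) * ((m + k) choose k)"
    using Suc_times_binomial_eq[of "m + k" k] by (simp add: mult.commute)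
  then have "real (Suc k) * real ((m + Suc k) choose Suc k) = real (m + Suc k) * real ((m + k) choose k)"
    by (metis of_nat_mult)
  then have "real ((m + Suc k) choose Suc k) = real ((m + k) choose k) * (real (m + Suc k) / real (Suc k))"
    by (simp add: field_simps del: binomial_Suc_Suc)
  then show ?case
    unfolding Suc.IH by (simp add: add_ac)
qed simp

lemma binomial_absorb_real:
  assumes "k < n"
  shows "real (n choose Suc k) = real (n choose k) * (real (n - k) / real (Suc k))"
proof -
  have "Suc k * (n choose Suc k) = (n choose k) * (n - k)"
    using binomial_absorb_comp[of n k] binomial_absorption[of k n] by (simp only: mult.commute)
  then have "real (Suc k) * real (n choose Suc k) = real (n choose k) * real (n - k)"
    by (metis of_nat_mult)
  then show ?thesis by (simp add: field_simps del: binomial_Suc_Suc)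
qed

section \<open>Upper tails relative to their first term\<close>

fun horner_step :: "int \<Rightarrow> int \<Rightarrow> int \<Rightarrow> int \<Rightarrow> int \<times> int \<Rightarrow> int \<times> int" where
  "horner_step n a b j (l, h) =
     (mantissa_one + l * ((n - j) * a) div ((j + 1) * b), mantissa_one + (h * ((n - j) * a) div ((j + 1) * b) + 1))"

text \<open>The start interval from 1 to 8, in units of \<open>2^-64\<close>, stands for the whole
  truncated remainder beyond \<open>t\<close>. The innermost step is the one at \<open>t\<close>,
  the outermost the one at \<open>k\<close>.\<close>

definition horner :: "int \<Rightarrow> int \<Rightarrow> int \<Rightarrow> int \<Rightarrow> int \<Rightarrow> int \<times> int" where
  "horner n a b k t = foldr (horner_step n a b) [k..t] (mantissa_one, 8 * mantissa_one)"

context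
  fixes n :: nat and a b :: int and q :: real
  assumes ab: "0 < a" "0 < b" and q: "q = of_int a / of_int (a + b)"
begin

lemma q_bounds: "0 < q" "q < 1" "1 - q = of_int b / of_int (a + b)"
  using ab by (auto simp: q field_simps)

text \<open>This is the nested sum \<open>1 + r_j (1 + r_{j+1} (1 + ...))\<close>, with
  \<open>step_ratio\<close> as \<open>r_j\<close>.\<close>

definition tail_ratio :: "nat \<Rightarrow> real" where
  "tail_ratio j = measure_pmf.prob (binomial_pmf n q) {j..} / pmf (binomial_pmf n q) j"

definition step_ratio :: "nat \<Rightarrow> real" where
  "step_ratio j = of_int ((int n - int j) * a) / of_int ((int j + 1) * b)"

lemma pmf_pos: "j \<le> n \<Longrightarrow> 0 < pmf (binomial_pmf n q) j"
  using q_bounds by simp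

lemma pmf_Suc:
  assumes "j < n"
  shows "pmf (binomial_pmf n q) (Suc j) = pmf (binomial_pmf n q) j * step_ratio j"
proof -
  have "n - j = Suc (n - Suc j)" using assms by simp
  then have "(1 - q) ^ (n - j) = (1 - q) * (1 - q) ^ (n - Suc j)" by simp
  moreover have "q = (1 - q) * (of_int a / of_int b)"
    using ab unfolding q_bounds(3) by (simp add: q)
  moreover have "step_ratio j = real (n - j) / real (Suc j) * (of_int a / of_int b)"
    using assms by (simp add: step_ratio_def of_nat_diff add.commute)
  ultimately show ?thesis
    using q_bounds binomial_absorb_real[OF assms] by (simp del: binomial_Suc_Suc)
qed

text \<open>Writing the first term with the odds \<open>a / b\<close> gives the exponents
  \<open>k\<close> and \<open>n\<close> instead of \<open>k\<close> and
  \<open>n - k\<close>.\<close>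

lemma prob_atLeast_eq:
  assumes "k \<le> n"
  shows "measure_pmf.prob (binomial_pmf n q) {k..} =
           real (n choose k) * ((of_int a / of_int b) ^ k * (of_int b / of_int (a + b)) ^ n) * tail_ratio k"
proof -
  have "(1 - q) ^ n = (1 - q) ^ (n - k) * (1 - q) ^ k"
    using assms by (simp flip: power_add)
  moreover have "q = of_int a / of_int b * (1 - q)"
    using ab unfolding q_bounds(3) by (simp add: q)
  then have "q ^ k = (of_int a / of_int b) ^ k * (1 - q) ^ k"
    by (metis power_mult_distrib)
  ultimately have eq: "pmf (binomial_pmf n q) k =
      real (n choose k) * ((of_int a / of_int b) ^ k * (of_int b / of_int (a + b)) ^ n)"
    using q_bounds by (simp flip: q_bounds(3))
  then show ?thesis
    using pmf_pos[OF assms] unfolding eq[symmetric] tail_ratio_def by (simp del: pmf_binomial)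
qed

text \<open>Splitting off the mass at \<open>j\<close> and dividing by it turns the rest of the tail
  into the step ratio times the next tail ratio.\<close>

lemma tail_ratio_rec:
  assumes "j < n"
  shows "tail_ratio j = 1 + step_ratio j * tail_ratio (Suc j)"
proof -
  have "step_ratio j \<noteq> 0"
    using assms ab by (auto simp: step_ratio_def)
  then show ?thesis
    using pmf_pos[of j] pmf_pos[of "Suc j"] assms
    by (simp add: tail_ratio_def prob_atLeast[of _ j] pmf_Suc[OF assms] field_simps del: pmf_binomial)
qed

lemma tail_ratio_last: "tail_ratio n = 1"
proof -
  have "measure_pmf.prob (binomial_pmf n q) {Suc n..} = 0"
    using q_bounds by (subst measure_pmf_zero_iff) auto
  then show ?thesis
    using pmf_pos[of n] by (simp add: tail_ratio_def prob_atLeast[of _ n] del: pmf_binomial)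
qed

lemma tail_ratio_ge_1: "j \<le> n \<Longrightarrow> 1 \<le> tail_ratio j"
  using pmf_pos[of j] by (simp add: tail_ratio_def prob_atLeast[of _ j] del: pmf_binomial)

text \<open>The assumption says that the step ratio at \<open>k\<close>, hence at every \<open>j \<ge> k\<close>, is at most \<open>7 / 8\<close>, and
  \<open>1 + 7 / 8 * 8 = 8\<close>.\<close>

lemma tail_ratio_le_8:
  assumes k: "8 * ((int n - int k) * a) \<le> 7 * ((int k + 1) * b)" and "k \<le> j" "j \<le> n"
  shows "tail_ratio j \<le> 8"
  using assms(3,2)
proof (induction rule: inc_induct)
  case base
  show ?case by (simp add: tail_ratio_last)
next
  case (step j)
  have "8 * ((int n - int j) * a) \<le> 8 * ((int n - int k) * a)"
    using step ab by (simp add: mult_right_mono)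
  also note k
  also have "7 * ((int k + 1) * b) \<le> 7 * ((int j + 1) * b)"
    using step ab by (simp add: mult_right_mono)
  finally have "real_of_int (8 * ((int n - int j) * a)) \<le> of_int (7 * ((int j + 1) * b))"
    by (simp only: of_int_le_iff)
  moreover have "(0 :: real) < of_int ((int j + 1) * b)"
    using ab by simp
  ultimately have "step_ratio j \<le> 7 / 8"
    unfolding step_ratio_def by (simp add: pos_divide_le_eq del: of_int_mult of_int_add of_int_diff)
  moreover have "0 \<le> tail_ratio (Suc j)" "tail_ratio (Suc j) \<le> 8"
    using step tail_ratio_ge_1[of "Suc j"] by simp_all
  ultimately have "step_ratio j * tail_ratio (Suc j) \<le> 7 / 8 * 8"
    by (intro mult_mono) auto
  then show ?case
    using step tail_ratio_rec[of j] by simp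
qed

text \<open>Downward induction from \<open>Suc t\<close> to \<open>k\<close>: each step applies the
  recursion of \<open>tail_ratio\<close> to both endpoints, rounding outward.\<close>

lemma horner_tail_ratio:
  assumes k: "8 * ((int n - int k) * a) \<le> 7 * ((int k + 1) * b)" "k \<le> Suc t" "t < n"
    and lh: "horner (int n) a b (int k) (int t) = (l, h)"
  shows "encloses (l, h, -64) (tail_ratio k)"
proof -
  have "\<exists>l h. horner (int n) a b (int j) (int t) = (l, h) \<and>
          0 \<le> l \<and> of_int l \<le> of_int mantissa_one * tail_ratio j \<and> of_int mantissa_one * tail_ratio j \<le> of_int h"
    if "k \<le> j" "j \<le> Suc t" for j
    using that(2,1)
  proof (induction rule: inc_induct)
    \<comment> \<open>At \<open>Suc t\<close> the list is empty, so the start interval itself must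
      enclose the tail ratio.\<close>
    case base
    have "1 \<le> tail_ratio (Suc t)" "tail_ratio (Suc t) \<le> 8"
      using assms base tail_ratio_ge_1[of "Suc t"] tail_ratio_le_8[of k "Suc t"] by simp_all
    then show ?case
      by (simp add: horner_def mantissa_one_def)
  next
    case (step j)
    then obtain l h where lh: "horner (int n) a b (int (Suc j)) (int t) = (l, h)" "0 \<le> l"
        "of_int l \<le> of_int mantissa_one * tail_ratio (Suc j)" "of_int mantissa_one * tail_ratio (Suc j) \<le> of_int h"
      by auto
    have "[int j..int t] = int j # [int (Suc j)..int t]"
      using step upto_rec1[of "int j" "int t"] by (simp add: add.commute)
    then have eq: "horner (int n) a b (int j) (int t) = horner_step (int n) a b (int j) (l, h)"
      using lh(1) by (simp add: horner_def)
    let ?x = "(int n - int j) * a" and ?y = "(int j + 1) * b"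
    have xy: "0 \<le> ?x" "0 < ?y"
      using step assms ab by simp_all
    have r: "0 \<le> step_ratio j"
      using xy unfolding step_ratio_def by (intro divide_nonneg_nonneg) (simp_all only: of_int_0_le_iff less_imp_le)
    have "real_of_int (l * ?x div ?y) \<le> of_int (l * ?x) / of_int ?y"
      by (rule of_int_div_bounds[OF xy(2)])
    also have "\<dots> = of_int l * step_ratio j"
      by (simp add: step_ratio_def)
    also have "\<dots> \<le> of_int mantissa_one * tail_ratio (Suc j) * step_ratio j"
      by (intro mult_right_mono lh r)
    finally have lower: "real_of_int (l * ?x div ?y) \<le> of_int mantissa_one * tail_ratio (Suc j) * step_ratio j" .
    have "of_int mantissa_one * tail_ratio (Suc j) * step_ratio j \<le> of_int h * step_ratio j"
      by (intro mult_right_mono lh r)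
    also have "\<dots> = of_int (h * ?x) / of_int ?y"
      by (simp add: step_ratio_def)
    also have "\<dots> \<le> of_int (h * ?x div ?y + 1)"
      by (rule of_int_div_bounds[OF xy(2)])
    finally have upper: "of_int mantissa_one * tail_ratio (Suc j) * step_ratio j \<le> of_int (h * ?x div ?y + 1)" .
    have "of_int mantissa_one * tail_ratio j = of_int mantissa_one + of_int mantissa_one * tail_ratio (Suc j) * step_ratio j"
      using step assms by (simp add: tail_ratio_rec algebra_simps)
    moreover have "0 \<le> l * ?x div ?y"
      using xy lh(2) by (simp add: pos_imp_zdiv_nonneg_iff)
    ultimately show ?case
      using lower upper unfolding eq by (simp add: mantissa_one_def)
  qed
  from this[of k] lh show ?thesis
    using assms by (auto simp: encloses_def mantissa_one_def power_int_minus field_simps)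
qed

end

text \<open>First term times nested sum. The enclosure \<open>C\<close> of the binomial coefficient
  is passed in, so one computation can serve several tails; the exponent \<open>-64\<close> undoes
  the fixed-point scaling.\<close>

definition tail_encl ::
  "int \<times> int \<times> int \<Rightarrow> int \<Rightarrow> int \<Rightarrow> num \<Rightarrow> num \<Rightarrow> int \<Rightarrow> int \<times> int \<times> int" where
  "tail_encl C a b n k t = times_encl
     (times_encl C (times_encl (pow_encl (scale_encl a b one_encl) k) (pow_encl (scale_encl b (a + b) one_encl) n)))
     ((\<lambda>(l, h). (l, h, -64)) (horner (numeral n) a b (numeral k) t))"

lemma encloses_binomial_tail:
  assumes C: "encloses C (real (numeral n choose numeral k))"
    and ab: "0 < a" "0 < b" and q: "q = of_int a / of_int (a + b)"
    and k: "8 * ((numeral n - numeral k) * a) \<le> 7 * ((numeral k + 1) * b)" "numeral k \<le> t" "t < numeral n"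
  shows "encloses (tail_encl C a b n k t) (measure_pmf.prob (binomial_pmf (numeral n) q) {numeral k..})"
proof -
  obtain l h where lh: "horner (numeral n) a b (numeral k) t = (l, h)" by fastforce
  let ?N = "numeral n :: nat" and ?K = "numeral k :: nat"
  have "int ?K \<le> int ?N" unfolding of_nat_numeral using k by linarith
  then have kn: "?K \<le> ?N" by (simp only: of_nat_le_iff)
  note prob_atLeast_eq[OF ab q kn]
  moreover have "encloses (l, h, -64) (tail_ratio ?N q ?K)"
  proof (rule horner_tail_ratio[OF ab q])
    have t: "0 \<le> t" using k(2) zero_le_numeral order_trans by blast
    show "8 * ((int ?N - int ?K) * a) \<le> 7 * ((int ?K + 1) * b)"
      unfolding of_nat_numeral by (rule k)
    have "int ?K \<le> t" "t < int ?N" unfolding of_nat_numeral by (rule k)+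
    then show "?K \<le> Suc (nat t)" "nat t < ?N" using t by linarith+
    show "horner (int ?N) a b (int ?K) (int (nat t)) = (l, h)"
      using t lh by simp
  qed
  moreover have "encloses (scale_encl a b one_encl) (of_int a / of_int b)"
      "encloses (scale_encl b (a + b) one_encl) (of_int b / of_int (a + b))"
    using encloses_scale[OF encloses_one, of a b] encloses_scale[OF encloses_one, of b "a + b"] ab by simp_all
  ultimately show ?thesis
    using C by (simp add: tail_encl_def lh encloses_times encloses_pow)
qed

text \<open>The products enter through equations, so that their long evaluations can be carried out
  in separate lemmas.\<close>

lemma encloses_binomial:
  assumes "fold times_int_encl [int m + 1..int m + int k] one_encl = X"
    and "fold times_int_encl [1..int k] one_encl = Y" and "0 < fst Y"
  shows "encloses (quotient_encl X Y) (real ((m + k) choose k))"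
  unfolding binomial_quotient_prod
  using encloses_prod_int[of "int m + 1" k] encloses_prod_int[of 1 k] assms
  by (intro encloses_quotient) (simp_all add: add_ac)

lemma encloses_binomial_Suc:
  assumes "encloses X (real (n choose k))" "k < n"
  shows "encloses (scale_encl (int n - int k) (int k + 1) X) (real (n choose Suc k))"
  using encloses_scale[OF assms(1), of "int n - int k" "int k + 1"] assms(2)
  by (simp add: binomial_absorb_real of_nat_diff add.commute del: binomial_Suc_Suc)

lemma encloses_binomial_add:
  assumes "encloses X (real (n choose k))" "k + j \<le> n"
  shows "encloses (fold (\<lambda>i. scale_encl (int n - i) (i + 1)) [int k..int k + int j - 1] X) (real (n choose (k + j)))"
  using assms(2)
proof (induction j)
  case 0
  then show ?case using assms(1) by simp
next
  case (Suc j)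
  have "[int k..int k + int (Suc j) - 1] = [int k..int k + int j - 1] @ [int k + int j]"
    using upto_rec2[of "int k" "int k + int j"] by simp
  then show ?case
    using encloses_binomial_Suc[OF Suc.IH] Suc.prems by (simp del: binomial_Suc_Suc)
qed

text \<open>Given \<open>C\<close> and \<open>q\<close>, all remaining hypotheses are integer
  statements that evaluation decides.\<close>

lemma binomial_tail_bounds:
  assumes "encloses C (real (numeral n choose numeral k))"
    and "q = of_int a / of_int (a + b)" "0 < a" "0 < b"
    and "8 * ((numeral n - numeral k) * a) \<le> 7 * ((numeral k + 1) * b)" "numeral k \<le> t" "t < numeral n"
    and "decimally_bounded A B d (tail_encl C a b n k t)"
  shows "measure_pmf.prob (binomial_pmf (numeral n) q) {numeral k..} \<in> {of_int A / 10 ^ d..of_int B / 10 ^ d}"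
  using decimally_bounded_bounds[OF encloses_binomial_tail[OF assms(1,3,4,2,5-7)] assms(8)] by simp

lemma power_product_bounds:
  fixes x y :: real
  assumes "x = of_int a / of_int b" "y = of_int a' / of_int b'" "0 < a" "0 < b" "0 < a'" "0 < b'"
    and "decimally_bounded A B d (times_encl (pow_encl (scale_encl a b one_encl) m) (pow_encl (scale_encl a' b' one_encl) n))"
  shows "x ^ numeral m * y ^ numeral n \<in> {of_int A / 10 ^ d..of_int B / 10 ^ d}"
proof -
  have "encloses (scale_encl a b one_encl) x" "encloses (scale_encl a' b' one_encl) y"
    using encloses_scale[OF encloses_one, of a b] encloses_scale[OF encloses_one, of a' b'] assms by simp_all
  then show ?thesis
    using decimally_bounded_bounds[OF encloses_times[OF encloses_pow encloses_pow] assms(7)] by simp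
qed

section \<open>Numerical values\<close>

text \<open>The falling product of the 1209 factors from 4096 down, the numerator of
  \<open>4096 choose 1209\<close>.\<close>

lemma fold_times_int_2888_4096:
  "fold times_int_encl [2888..4096] one_encl = (35463978408462528212, 35463978408462528528, 14156)"
  by code_simp

lemma fold_times_int_1_1209:
  "fold times_int_encl [1..1209] one_encl = (17648506617730257121928, 17648506617730257263127, 10568)"
  by code_simp

lemma encloses_4096_choose_1209:
  "encloses (2429288783061914096480, 2429288783061914137563, 3508) (real (4096 choose 1209))"
proof -
  have "encloses (quotient_encl (35463978408462528212, 35463978408462528528, 14156)
      (17648506617730257121928, 17648506617730257263127, 10568)) (real ((2887 + 1209) choose 1209))"
    using fold_times_int_2888_4096 fold_times_int_1_1209 by (intro encloses_binomial) simp_all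
  moreover have "quotient_encl (35463978408462528212, 35463978408462528528, 14156)
      (17648506617730257121928, 17648506617730257263127, 10568) =
      (2429288783061914096480, 2429288783061914137563, 3508)"
    by code_simp
  moreover have "2887 + 1209 = (4096 :: nat)" by simp
  ultimately show ?thesis by metis
qed

text \<open>Needed because reflection turns the lower tail below 1210 into the upper tail from
  2887.\<close>

lemma encloses_4096_choose_2887:
  "encloses (2429288783061914096480, 2429288783061914137563, 3508) (real (4096 choose 2887))"
proof -
  have "(4096 choose 2887 :: nat) = 4096 choose (4096 - 2887)"
    by (rule binomial_symmetric) simp
  also have "4096 - 2887 = (1209 :: nat)" by simp
  finally show ?thesis using encloses_4096_choose_1209 by metis
qed

definition C1210 where "C1210 = scale_encl 2887 1210 (2429288783061914096480, 2429288783061914137563, 3508)"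

lemma encloses_4096_choose_1210: "encloses C1210 (real (4096 choose 1210))"
proof -
  have "1210 = Suc 1209" by simp
  then show ?thesis
    using encloses_binomial_Suc[OF encloses_4096_choose_1209] unfolding C1210_def by simp
qed

text \<open>Twenty-four ratio steps replace a second pair of long products.\<close>

definition C1234 where
  "C1234 = fold (\<lambda>i. scale_encl (4096 - i) (i + 1)) [1210..1233] C1210"

lemma encloses_4096_choose_1234: "encloses C1234 (real (4096 choose 1234))"
  using encloses_binomial_add[OF encloses_4096_choose_1210, of 24] by (simp add: C1234_def)

lemma encloses_4096_choose_2862: "encloses C1234 (real (4096 choose 2862))"
proof -
  have "(4096 choose 2862 :: nat) = 4096 choose (4096 - 2862)"
    by (rule binomial_symmetric) simp
  also have "4096 - 2862 = (1234 :: nat)" by simp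
  finally show ?thesis using encloses_4096_choose_1234 by metis
qed

definition C1235 where "C1235 = scale_encl 2862 1235 C1234"

lemma encloses_4096_choose_1235: "encloses C1235 (real (4096 choose 1235))"
proof -
  have "1235 = Suc 1234" by simp
  then show ?thesis
    using encloses_binomial_Suc[OF encloses_4096_choose_1234] unfolding C1235_def by simp
qed

section \<open>The four error tails and the likelihood ratios\<close>

lemma fake_tail_third:
  "measure_pmf.prob (binomial_pmf 4096 (7 / 27)) {1210..} \<in>
     {of_int 1046943719579000000 / 10 ^ 25..of_int 1046943719579200000 / 10 ^ 25}"
  \<comment> \<open>The success probability 7/27 has odds 7/20. The cut at 1349 keeps 140 terms,
    whose step ratios fall from about 0.83 to 0.71.\<close>
  by (rule binomial_tail_bounds[where a = 7 and b = 20 and t = 1349, OF encloses_4096_choose_1210],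
      simp, code_simp+)

lemma genuine_tail_third:
  "measure_pmf.prob (binomial_pmf 4096 (2 / 3)) {2887..} \<in>
     {of_int 911453733633500000 / 10 ^ 25..of_int 911453733633549000 / 10 ^ 25}"
  by (rule binomial_tail_bounds[where a = 2 and b = 1 and t = 3026, OF encloses_4096_choose_2887],
      simp, code_simp+)

lemma fake_tail_5_16:
  "measure_pmf.prob (binomial_pmf 4096 (103 / 384)) {1235..} \<in>
     {of_int 1097167018000 / 10 ^ 18..of_int 1097167020000 / 10 ^ 18}"
  \<comment> \<open>Fewer digits are needed here, so 100 terms suffice.\<close>
  by (rule binomial_tail_bounds[where a = 103 and b = 281 and t = 1334, OF encloses_4096_choose_1235],
      simp, code_simp+)

lemma genuine_tail_5_16:
  "measure_pmf.prob (binomial_pmf 4096 (85 / 128)) {2862..} \<in>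
     {of_int 1168640349000 / 10 ^ 18..of_int 1168640351000 / 10 ^ 18}"
  by (rule binomial_tail_bounds[where a = 85 and b = 43 and t = 2961, OF encloses_4096_choose_2862],
      simp, code_simp+)

text \<open>The bases are the fake to genuine quotients at \<open>p = 5/16\<close>:
  (103/384)/(43/128) for a zero, (281/384)/(85/128) for a nonzero coefficient.\<close>

lemma likelihood_ratio_1234:
  "(103 / 129 :: real) ^ 1234 * (281 / 255) ^ 2862 \<in> {of_int 112 / 10 ^ 2..of_int 113 / 10 ^ 2}"
  by (rule power_product_bounds[where a = 103 and b = 129 and a' = 281 and b' = 255], simp, simp, code_simp+)

lemma likelihood_ratio_1235:
  "(103 / 129 :: real) ^ 1235 * (281 / 255) ^ 2861 \<in> {of_int 81 / 10 ^ 2..of_int 82 / 10 ^ 2}"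
  by (rule power_product_bounds[where a = 103 and b = 129 and a' = 281 and b' = 255], simp, simp, code_simp+)

section \<open>Error probabilities, optimal cutoff and advantage\<close>

lemma decimal_bounds:
  "prob_fake_as_genuine 4096 (1 / 3) (zero_test 1210) \<in>
     {1046943719579000000 / 10 ^ 25..1046943719579200000 / 10 ^ 25}"
  "prob_genuine_as_fake 4096 (1 / 3) (zero_test 1210) \<in>
     {911453733633500000 / 10 ^ 25..911453733633549000 / 10 ^ 25}"
  "prob_fake_as_genuine 4096 (5 / 16) (zero_test 1235) \<in>
     {1097167018000 / 10 ^ 18..1097167020000 / 10 ^ 18}"
  "prob_genuine_as_fake 4096 (5 / 16) (zero_test 1235) \<in>
     {1168640349000 / 10 ^ 18..1168640351000 / 10 ^ 18}"
proof -
  have q: "(1 - 2 * (1 / 3)^2) / 3 = (7 / 27 :: real)" "1 - 4 * (1 / 3) + 6 * (1 / 3)^2 = (1 / 3 :: real)"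
      "(1 - 2 * (5 / 16)^2) / 3 = (103 / 384 :: real)" "1 - 4 * (5 / 16) + 6 * (5 / 16)^2 = (43 / 128 :: real)"
    by (simp_all add: power2_eq_square)
  have p: "0 \<le> (1 / 3 :: real)" "1 / 3 \<le> (1 / 2 :: real)" "0 \<le> (5 / 16 :: real)" "5 / 16 \<le> (1 / 2 :: real)"
    by simp_all
  \<comment> \<open>The reflected cutoffs are \<open>4097 - 1210\<close> and
    \<open>4097 - 1235\<close>.\<close>
  have reflect: "measure_pmf.prob (binomial_pmf 4096 (1 / 3)) {..<1210} =
        measure_pmf.prob (binomial_pmf 4096 (2 / 3)) {2887..}"
      "measure_pmf.prob (binomial_pmf 4096 (43 / 128)) {..<1235} =
        measure_pmf.prob (binomial_pmf 4096 (85 / 128)) {2862..}"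
    using prob_binomial_lessThan_reflect[of "1 / 3" 1210 2887 4096]
      prob_binomial_lessThan_reflect[of "43 / 128" 1235 2862 4096] by simp_all
  show "prob_fake_as_genuine 4096 (1 / 3) (zero_test 1210) \<in>
      {1046943719579000000 / 10 ^ 25..1046943719579200000 / 10 ^ 25}"
    unfolding prob_fake_as_genuine_zero_test[OF p(1,2)] q using fake_tail_third by simp
  show "prob_genuine_as_fake 4096 (1 / 3) (zero_test 1210) \<in>
      {911453733633500000 / 10 ^ 25..911453733633549000 / 10 ^ 25}"
    unfolding prob_genuine_as_fake_zero_test[OF p(1,2)] q reflect using genuine_tail_third by simp
  show "prob_fake_as_genuine 4096 (5 / 16) (zero_test 1235) \<in>
      {1097167018000 / 10 ^ 18..1097167020000 / 10 ^ 18}"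
    unfolding prob_fake_as_genuine_zero_test[OF p(3,4)] q using fake_tail_5_16 by simp
  show "prob_genuine_as_fake 4096 (5 / 16) (zero_test 1235) \<in>
      {1168640349000 / 10 ^ 18..1168640351000 / 10 ^ 18}"
    unfolding prob_genuine_as_fake_zero_test[OF p(3,4)] q reflect using genuine_tail_5_16 by simp
qed

lemma optimal_cutoff_5_16:
  "{\<tau>. is_arg_max (\<lambda>\<tau>. advantage 4096 (5 / 16) (zero_test \<tau>)) (\<lambda>_. True) \<tau>} = {1235}"
proof (rule optimal_cutoff[where a = "103 / 384" and b = "43 / 128" and k = 1234 and j = 2862 and i = 2861])
  have "(1 :: real) < of_int 112 / 10 ^ 2" "of_int 82 / 10 ^ 2 < (1 :: real)"
    by simp_all
  then show "1 < (103 / 129 :: real) ^ 1234 * (281 / 255) ^ 2862" "(103 / 129 :: real) ^ 1235 * (281 / 255) ^ 2861 < 1"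
    using likelihood_ratio_1234 likelihood_ratio_1235
    unfolding atLeastAtMost_iff by (blast intro: less_le_trans le_less_trans)+
qed (simp_all add: power2_eq_square)

theorem mainTheorem6:
  fixes d :: nat
  assumes "d = 4096"
  shows
    "rounds_to (prob_fake_as_genuine d (1 / 3) (zero_test 1210)) (1.046943719579 / 10 ^ 7) 19 \<and>
     rounds_to (prob_genuine_as_fake d (1 / 3) (zero_test 1210)) (9.114537336335 / 10 ^ 8) 20 \<and>
     rounds_to (advantage d (1 / 3) (zero_test 1210)) 0.999999804160 12 \<and>
     {\<tau>. is_arg_max (\<lambda>\<tau>. advantage d (5 / 16) (zero_test \<tau>)) (\<lambda>_. True) \<tau>} = {1235} \<and>
     rounds_to (advantage d (5 / 16) (zero_test 1235)) 0.999997734193 12"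
proof -
  note bounds = decimal_bounds[unfolded atLeastAtMost_iff]
  have "rounds_to (prob_fake_as_genuine 4096 (1 / 3) (zero_test 1210)) (1.046943719579 / 10 ^ 7) 19"
    using bounds(1) unfolding rounds_to_def abs_less_iff by simp
  moreover have "rounds_to (prob_genuine_as_fake 4096 (1 / 3) (zero_test 1210)) (9.114537336335 / 10 ^ 8) 20"
    using bounds(2) unfolding rounds_to_def abs_less_iff by simp
  \<comment> \<open>The two error intervals are so narrow that their sum determines the twelfth
    digit.\<close>
  moreover have "rounds_to (advantage 4096 (1 / 3) (zero_test 1210)) 0.999999804160 12"
    using bounds(1,2) unfolding advantage_def rounds_to_def abs_less_iff by simp
  moreover have "rounds_to (advantage 4096 (5 / 16) (zero_test 1235)) 0.999997734193 12"
    using bounds(3,4) unfolding advantage_def rounds_to_def abs_less_iff by simp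
  ultimately show ?thesis
    using optimal_cutoff_5_16 unfolding assms by blast
qed

end
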